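(* Let $\phi:\mathbb{R}\to\mathbb{R}_+$ be convex and let $h:\mathbb{R}\to\mathbb{R}$ be a function with $h(0)=0$. Let $\varphi$ be the surrogate loss $$\varphi(\alpha,Y)=\sum_{i,j}h(Y_{ij})\,\phi(\alpha_i-\alpha_j).$$ Then even in the low-noise setting $\varphi$ is not structure-consistent with respect to the pairwise loss $L$; that is, there exist a number of items $m$ and a low-noise probability measure $\mu$ on weighted adjacency matrices of directed acyclic graphs on $m$ nodes such that the strict inequality $$\inf_{\alpha\in\mathbb{R}^m}\ell_\varphi(\alpha,\mu)<\inf_{\alpha\in\mathbb{R}^m}\Bigl\{\ell_\varphi(\alpha,\mu)\ \Big|\ \alpha\notin\operatorname{argmin}_{\alpha'}\ell(\alpha',\mu)\Bigr\}$$ fails.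
   Context: A preference judgment is the weighted adjacency matrix $Y\in\mathbb{R}_+^{m\times m}$ of a weighted directed acyclic graph on nodes $\{1,\dots,m\}$: $Y_{ij}>0$ is the weight of the edge $i\to j$, and $Y_{ij}=0$ if there is no such edge. The structures are single judgments $Y$ (no aggregation). Pairwise loss: for $\alpha\in\mathbb{R}^m$, $L(\alpha,Y)=\sum_{i<j}Y_{ij}1(\alpha_i\le\alpha_j)+\sum_{i>j}Y_{ij}1(\alpha_i<\alpha_j)$. For a probability measure $\mu$ on such matrices, $\ell(\alpha,\mu)=\int L(\alpha,Y)\,d\mu(Y)$, $\ell_\varphi(\alpha,\mu)=\int\varphi(\alpha,Y)\,d\mu(Y)$, and $Y^\mu_{ij}=\int Y_{ij}\,d\mu(Y)$. Structure-consistency of $\varphi$ with respect to $L$ means that the displayed strict inequality holds for every $\mu$ (with $\inf\emptyset=+\infty$). Difference graph: $G_\mu$ is the directed graph on $\{1,\dots,m\}$ in which the edge $i\to j$ is present iff $Y^\mu_{ij}>Y^\mu_{ji}$, with weight $Y^\mu_{ij}-Y^\mu_{ji}$. Low-noise: $\mu$ is low-noise if whenever $i\to j$ and $j\to k$ are edges of $G_\mu$, the weight $Y^\mu_{ik}-Y^\mu_{ki}$ on the edge $i\to k$ is greater than or equal to $(Y^\mu_{ij}-Y^\mu_{ji})+(Y^\mu_{jk}-Y^\mu_{kj})$. *)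

theory Defs
  imports "HOL-Probability.Probability"
begin

text \<open>Vectors in \<open>\<real>^m\<close> and real \<open>m \<times> m\<close> matrices are extensional functions on the index sets
  \<open>{1..m}\<close> and \<open>{1..m} \<times> {1..m}\<close>, so that \<open>m\<close> can be quantified inside a formula.\<close>

definition score_vectors :: "nat \<Rightarrow> (nat \<Rightarrow> real) set" where
  "score_vectors m = {1..m} \<rightarrow>\<^sub>E UNIV"

definition edges :: "nat \<Rightarrow> (nat \<times> nat \<Rightarrow> real) \<Rightarrow> (nat \<times> nat) set" where
  "edges m Y = {(i, j) \<in> {1..m} \<times> {1..m}. Y (i, j) > 0}"

definition judgments :: "nat \<Rightarrow> (nat \<times> nat \<Rightarrow> real) set" where
  "judgments m = {Y \<in> {1..m} \<times> {1..m} \<rightarrow>\<^sub>E {0..}. acyclic (edges m Y)}"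

text \<open>The Borel sigma-algebra of \<open>\<real>^(m \<times> m)\<close>, traced on the set of judgments.\<close>

definition judgment_algebra :: "nat \<Rightarrow> (nat \<times> nat \<Rightarrow> real) measure" where
  "judgment_algebra m =
     restrict_space (\<Pi>\<^sub>M p\<in>{1..m} \<times> {1..m}. (borel :: real measure)) (judgments m)"

definition judgment_measure :: "nat \<Rightarrow> (nat \<times> nat \<Rightarrow> real) measure \<Rightarrow> bool" where
  "judgment_measure m \<mu> \<longleftrightarrow> prob_space \<mu> \<and> sets \<mu> = sets (judgment_algebra m)"

definition pairwise_loss :: "nat \<Rightarrow> (nat \<Rightarrow> real) \<Rightarrow> (nat \<times> nat \<Rightarrow> real) \<Rightarrow> real" where
  "pairwise_loss m \<alpha> Y =
     (\<Sum>(i, j) \<in> {(i, j) \<in> {1..m} \<times> {1..m}. i < j}. Y (i, j) * of_bool (\<alpha> i \<le> \<alpha> j)) +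
     (\<Sum>(i, j) \<in> {(i, j) \<in> {1..m} \<times> {1..m}. i > j}. Y (i, j) * of_bool (\<alpha> i < \<alpha> j))"

definition surrogate_loss ::
    "(real \<Rightarrow> real) \<Rightarrow> (real \<Rightarrow> real) \<Rightarrow> nat \<Rightarrow> (nat \<Rightarrow> real) \<Rightarrow> (nat \<times> nat \<Rightarrow> real) \<Rightarrow> real" where
  "surrogate_loss h \<phi> m \<alpha> Y = (\<Sum>i\<in>{1..m}. \<Sum>j\<in>{1..m}. h (Y (i, j)) * \<phi> (\<alpha> i - \<alpha> j))"

text \<open>The weight transformation in the surrogate loss need not be Borel. Integrating over the completion
  of \<open>\<mu>\<close> gives the usual integral of functions that are only almost everywhere equal to a Borel
  function; without it such integrands would silently get the Bochner integral 0. For Borel integrands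
  nothing changes.\<close>

definition risk ::
    "(nat \<times> nat \<Rightarrow> real) measure \<Rightarrow> ((nat \<Rightarrow> real) \<Rightarrow> (nat \<times> nat \<Rightarrow> real) \<Rightarrow> real)
      \<Rightarrow> (nat \<Rightarrow> real) \<Rightarrow> real" where
  "risk \<mu> f \<alpha> = (\<integral>Y. f \<alpha> Y \<partial>completion \<mu>)"

lemma risk_borel:
  assumes "f \<alpha> \<in> borel_measurable \<mu>"
  shows "risk \<mu> f \<alpha> = (\<integral>Y. f \<alpha> Y \<partial>\<mu>)"
  using assms by (simp add: risk_def integral_completion)

definition mean_weight :: "(nat \<times> nat \<Rightarrow> real) measure \<Rightarrow> nat \<Rightarrow> nat \<Rightarrow> real" where
  "mean_weight \<mu> i j = (\<integral>Y. Y (i, j) \<partial>\<mu>)"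

definition diff_weight :: "(nat \<times> nat \<Rightarrow> real) measure \<Rightarrow> nat \<Rightarrow> nat \<Rightarrow> real" where
  "diff_weight \<mu> i j = mean_weight \<mu> i j - mean_weight \<mu> j i"

definition diff_edges :: "nat \<Rightarrow> (nat \<times> nat \<Rightarrow> real) measure \<Rightarrow> (nat \<times> nat) set" where
  "diff_edges m \<mu> = {(i, j) \<in> {1..m} \<times> {1..m}. mean_weight \<mu> i j > mean_weight \<mu> j i}"

definition low_noise :: "nat \<Rightarrow> (nat \<times> nat \<Rightarrow> real) measure \<Rightarrow> bool" where
  "low_noise m \<mu> \<longleftrightarrow>
     (\<forall>i j k. (i, j) \<in> diff_edges m \<mu> \<longrightarrow> (j, k) \<in> diff_edges m \<mu> \<longrightarrow>
        diff_weight \<mu> i k \<ge> diff_weight \<mu> i j + diff_weight \<mu> j k)"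

definition optimal_scores :: "nat \<Rightarrow> (nat \<times> nat \<Rightarrow> real) measure \<Rightarrow> (nat \<Rightarrow> real) set" where
  "optimal_scores m \<mu> =
     {\<alpha>. is_arg_min (risk \<mu> (pairwise_loss m)) (\<lambda>\<beta>. \<beta> \<in> score_vectors m) \<alpha>}"

end

theory Submission
  imports Defs
begin

text \<open>All measures are mixtures of judgments with a single edge. If \<open>h v \<le> 0\<close> for some \<open>v > 0\<close>, or if
  \<open>h w / w\<close> is not constant for \<open>w > 0\<close>, then two items suffice: two opposite edges can be
  mixed so that the surrogate risk gains nothing from ranking the items by their mean weights.
  Otherwise \<open>h w = c w\<close> with \<open>c > 0\<close>. If \<open>\<phi>\<close> has a subgradient \<open>d \<ge> 0\<close> at \<open>0\<close>, a tie is as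
  good as any correct ranking of two items. If \<open>d < 0\<close>, then nonnegativity forces \<open>\<phi>\<close> to flatten out, so it has the
  subgradient \<open>d / 2\<close> at some \<open>t \<ge> 0\<close> and a subgradient \<open>e \<le> d\<close> at \<open>- t\<close>. The gap between
  \<open>e\<close> and \<open>d / 2\<close> leaves room for a low-noise measure on three items with \<open>1 \<rightarrow> 2\<close>, \<open>2 \<rightarrow> 3\<close>,
  \<open>1 \<rightarrow> 3\<close> whose surrogate risk is minimal at the scores \<open>(0, 0, - t)\<close>, which tie \<open>1\<close> and \<open>2\<close>.\<close>

section \<open>Supporting lines of convex functions on the real line\<close>

lemma convex_subgradient_exists:
  fixes f :: "real \<Rightarrow> real"
  assumes "convex_on UNIV f"
  shows "\<exists>d. \<forall>y. f y \<ge> f x + d * (y - x)"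
  using convex_le_Inf_differential[OF assms, of x] by auto

text \<open>A global minimiser of \<open>f x - p * x\<close> has subgradient \<open>p\<close>. Left
  of 0 the steeper slope \<open>d\<close> keeps this function above its value at 0; right of
  \<open>B\<close> nonnegativity of \<open>f\<close> does. So a minimum over the compact interval
  between is global.\<close>

lemma convex_subgradient_of_slope:
  fixes f :: "real \<Rightarrow> real"
  assumes f: "convex_on UNIV f" and nonneg: "\<And>x. 0 \<le> f x"
    and d: "\<And>y. f y \<ge> f 0 + d * y" and p: "d < p" "p < 0"
  shows "\<exists>t\<ge>0. \<forall>y. f y \<ge> f t + p * (y - t)"
proof -
  define g where "g = (\<lambda>x. f x - p * x)"
  define B where "B = f 0 / (- p)"
  have B: "0 \<le> B" using nonneg[of 0] p by (simp add: B_def divide_simps)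
  have "continuous_on UNIV f"
    using f by (intro convex_on_continuous) auto
  then have "continuous_on {0..B} g"
    unfolding g_def by (intro continuous_intros) (auto intro: continuous_on_subset)
  then obtain t where t: "t \<in> {0..B}" "\<And>x. x \<in> {0..B} \<Longrightarrow> g t \<le> g x"
    using continuous_attains_inf[of "{0..B}" g] B by auto
  have "g t \<le> g x" for x
  proof -
    have t0: "g t \<le> f 0" using t(2)[of 0] B by (simp add: g_def)
    consider "x < 0" | "x \<in> {0..B}" | "B < x" by force
    then show ?thesis
    proof cases
      case 1
      then have "0 \<le> (d - p) * x" using p by (simp add: mult_nonpos_nonpos)
      then show ?thesis using d[of x] t0 by (simp add: g_def algebra_simps)
    next
      case 3
      then have "f 0 \<le> - p * x" using p by (simp add: B_def field_simps)
      then show ?thesis using nonneg[of x] t0 by (simp add: g_def)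
    qed (use t in auto)
  qed
  then show ?thesis
    using t(1) by (intro exI[of _ t]) (auto simp: g_def algebra_simps)
qed

lemma convex_bounded_above_const:
  fixes f :: "real \<Rightarrow> real"
  assumes f: "convex_on UNIV f" and b: "\<And>x. f x \<le> b"
  shows "f x = f y"
proof -
  have "d = 0" if d: "\<And>y. f y \<ge> f x + d * (y - x)" for d x
  proof (rule ccontr)
    assume "d \<noteq> 0"
    then show False
      \<comment> \<open>At this point the supporting line takes the value
        \<open>b + 1\<close>.\<close>
      using d[of "x + (b - f x + 1) / d"] b[of "x + (b - f x + 1) / d"] by simp
  qed
  then have "f x \<le> f y" for x y
    using convex_subgradient_exists[OF f, of x] by fastforce
  then show ?thesis by (simp add: antisym)
qed

section \<open>Finite mixtures of judgments and their risks\<close>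

text \<open>Singletons are measurable, so every \<open>f\<close>, Borel or not, agrees almost
  everywhere with a finite combination of indicators. Hence it is measurable for the completion and
  its integral is a finite sum.\<close>

lemma finite_judgment_measure:
  fixes p :: "'i \<Rightarrow> real" and Y :: "'i \<Rightarrow> nat \<times> nat \<Rightarrow> real"
  assumes I: "finite I" and p: "\<And>i. i \<in> I \<Longrightarrow> 0 \<le> p i" "sum p I = 1"
    and Y: "\<And>i. i \<in> I \<Longrightarrow> Y i \<in> judgments m"
  obtains \<mu> where "judgment_measure m \<mu>"
    "\<And>f :: (nat \<times> nat \<Rightarrow> real) \<Rightarrow> real. integrable (completion \<mu>) f"
    "\<And>f. (\<integral>Z. f Z \<partial>completion \<mu>) = (\<Sum>i\<in>I. p i * f (Y i))"
proof
  define N where "N = point_measure I (\<lambda>i. ennreal (p i))"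
  define \<mu> where "\<mu> = distr N (judgment_algebra m) Y"
  have space: "space (judgment_algebra m) = judgments m"
    by (auto simp: judgment_algebra_def space_restrict_space space_PiM judgments_def)
  have meas: "Y \<in> N \<rightarrow>\<^sub>M judgment_algebra m"
    using Y by (simp add: N_def space)
  have sets: "sets \<mu> = sets (judgment_algebra m)" by (simp add: \<mu>_def)
  interpret N: prob_space N
    using I p by (intro prob_spaceI) (simp add: N_def space_point_measure emeasure_point_measure_finite)
  interpret \<mu>: prob_space \<mu>
    unfolding \<mu>_def by (rule N.prob_space_distr[OF meas])
  show "judgment_measure m \<mu>"
    by (simp add: judgment_measure_def \<mu>.prob_space_axioms sets)
  have singleton: "{Z} \<in> sets \<mu>" if "Z \<in> judgments m" for Z
  proof -
    have "{Z} = (\<Pi>\<^sub>E p\<in>{1..m} \<times> {1..m}. {Z p}) \<inter> judgments m"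
      using that PiE_singleton[of Z "{1..m} \<times> {1..m}"] by (auto simp: judgments_def PiE_def)
    moreover have "(\<Pi>\<^sub>E p\<in>{1..m} \<times> {1..m}. {Z p}) \<in> sets (\<Pi>\<^sub>M p\<in>{1..m} \<times> {1..m}. (borel :: real measure))"
      by (rule sets_PiM_I_finite) auto
    ultimately show ?thesis
      by (auto simp: sets judgment_algebra_def sets_restrict_space)
  qed
  have AE_image: "AE Z in \<mu>. Z \<in> Y ` I"
  proof -
    have "Y ` I \<in> sets \<mu>"
      using I Y by (intro sets.finite_UN[of I "\<lambda>i. {Y i}", simplified UNION_singleton_eq_range] singleton) auto
    then have "{Z \<in> space (judgment_algebra m). Z \<in> Y ` I} \<in> sets (judgment_algebra m)"
      using sets.sets_into_space sets by (metis Collect_mem_eq Int_commute Int_def inf.absorb_iff2 sets_eq_imp_space_eq)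
    then show ?thesis
      unfolding \<mu>_def by (subst AE_distr_iff[OF meas]) (auto simp: N_def space_point_measure intro!: AE_I2)
  qed
  fix f :: "(nat \<times> nat \<Rightarrow> real) \<Rightarrow> real"
  \<comment> \<open>Summing over the image rather than over \<open>I\<close> counts a judgment hit
    by several indices only once.\<close>
  define g where "g = (\<lambda>Z. \<Sum>W\<in>Y ` I. f W * indicator {W} Z)"
  have g: "g \<in> borel_measurable \<mu>"
    unfolding g_def using Y
    by (intro borel_measurable_sum borel_measurable_times borel_measurable_indicator singleton) auto
  have fg: "f Z = g Z" if "Z \<in> Y ` I" for Z
    using that I by (auto simp: g_def indicator_def)
  have AE: "AE Z in completion \<mu>. g Z = f Z"
    using AE_image by (intro AE_completion) (auto elim!: eventually_mono simp: fg)
  have g_int: "integrable \<mu> g"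
    unfolding \<mu>_def using g integrable_point_measure_finite[OF I, of p "\<lambda>i. g (Y i)"]
    by (subst integrable_distr_eq[OF meas]) (simp_all add: N_def \<mu>_def)
  have f: "f \<in> borel_measurable (completion \<mu>)"
  proof (rule measurableI)
    fix A :: "real set" assume "A \<in> sets borel"
    then have "g -` A \<inter> space (completion \<mu>) \<in> sets (completion \<mu>)"
      by (rule measurable_sets[OF measurable_completion[OF g]])
    then show "f -` A \<inter> space (completion \<mu>) \<in> sets (completion \<mu>)"
      by (rule completion.in_sets_AE[rotated]) (use AE in \<open>auto elim!: eventually_mono\<close>)
  qed simp
  show "integrable (completion \<mu>) f"
    using integrable_cong_AE_imp[of "completion \<mu>" g f] g_int g f AE by (auto simp: integrable_completion)
  have "(\<integral>Z. f Z \<partial>completion \<mu>) = (\<integral>Z. g Z \<partial>\<mu>)"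
    using integral_cong_AE[OF measurable_completion[OF g] f AE]
    by (simp add: integral_completion[OF g])
  also have "\<dots> = (\<Sum>i\<in>I. p i * g (Y i))"
    unfolding \<mu>_def using g I p
    by (subst integral_distr[OF meas]) (simp_all add: \<mu>_def N_def lebesgue_integral_point_measure_finite)
  also have "\<dots> = (\<Sum>i\<in>I. p i * f (Y i))"
    by (intro sum.cong) (auto simp: fg)
  finally show "(\<integral>Z. f Z \<partial>completion \<mu>) = (\<Sum>i\<in>I. p i * f (Y i))" .
qed

text \<open>One edge between distinct items is never cyclic, so a mixture of such judgments can put
  mean weight even on opposite edges.\<close>

definition single_edge :: "nat \<Rightarrow> nat \<times> nat \<Rightarrow> real \<Rightarrow> nat \<times> nat \<Rightarrow> real" where
  "single_edge m e w = (\<lambda>p\<in>{1..m} \<times> {1..m}. if p = e then w else 0)"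

lemma single_edge_in_judgments:
  assumes "i \<noteq> j" "0 \<le> w"
  shows "single_edge m (i, j) w \<in> judgments m"
proof -
  have "edges m (single_edge m (i, j) w) \<subseteq> {(i, j)}"
    by (auto simp: edges_def single_edge_def split: if_splits)
  moreover have "acyclic {(i, j)}" using assms by (simp add: acyclic_insert) (simp add: acyclic_def)
  ultimately have "acyclic (edges m (single_edge m (i, j) w))" by (rule acyclic_subset[rotated])
  then show ?thesis using assms by (auto simp: judgments_def single_edge_def)
qed

lemma surrogate_loss_single_edge:
  assumes "h 0 = 0" "i \<in> {1..m}" "j \<in> {1..m}"
  shows "surrogate_loss h \<phi> m \<alpha> (single_edge m (i, j) w) = h w * \<phi> (\<alpha> i - \<alpha> j)"
proof -
  have "surrogate_loss h \<phi> m \<alpha> (single_edge m (i, j) w)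
      = (\<Sum>k\<in>{1..m}. \<Sum>l\<in>{1..m}. if k = i then if l = j then h w * \<phi> (\<alpha> i - \<alpha> j) else 0 else 0)"
    unfolding surrogate_loss_def using assms by (intro sum.cong) (auto simp: single_edge_def)
  also have "\<dots> = (\<Sum>k\<in>{1..m}. if k = i then h w * \<phi> (\<alpha> i - \<alpha> j) else 0)"
    using assms by (intro sum.cong) (auto simp: sum.delta)
  finally show ?thesis using assms by simp
qed

lemma pairwise_loss_single_edge:
  assumes "i \<noteq> j" "i \<in> {1..m}" "j \<in> {1..m}"
  shows "pairwise_loss m \<alpha> (single_edge m (i, j) w) =
    w * of_bool (if i < j then \<alpha> i \<le> \<alpha> j else \<alpha> i < \<alpha> j)"
proof -
  have eq: "(\<Sum>(k, l)\<in>A. single_edge m (i, j) w (k, l) * of_bool (P k l)) =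
      (if (i, j) \<in> A then w * of_bool (P i j) else 0)"
    if "A \<subseteq> {1..m} \<times> {1..m}" for A P
  proof -
    have "finite A" using that by (rule finite_subset) simp
    moreover have "(\<Sum>(k, l)\<in>A. single_edge m (i, j) w (k, l) * of_bool (P k l)) =
        (\<Sum>e\<in>A. if e = (i, j) then w * of_bool (P i j) else 0)"
    proof (intro sum.cong refl)
      fix e assume "e \<in> A"
      then have "e \<in> {1..m} \<times> {1..m}" using that by blast
      then show "(case e of (k, l) \<Rightarrow> single_edge m (i, j) w (k, l) * of_bool (P k l)) =
          (if e = (i, j) then w * of_bool (P i j) else 0)"
        by (cases e) (simp add: single_edge_def)
    qed
    ultimately show ?thesis by simp
  qed
  have "{(k, l) \<in> {1..m} \<times> {1..m}. k < l} \<subseteq> {1..m} \<times> {1..m}"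
    "{(k, l) \<in> {1..m} \<times> {1..m}. k > l} \<subseteq> {1..m} \<times> {1..m}" by auto
  then show ?thesis
    unfolding pairwise_loss_def using assms by (simp add: eq)
qed

text \<open>An edge enters the pairwise risk with \<open>p * w\<close> and the surrogate risk with
  \<open>p * h w\<close>; the counterexamples for nonlinear \<open>h\<close> exploit this
  difference. Absent edges vanish from the surrogate because \<open>h 0 = 0\<close>.\<close>

lemma single_edge_mixture:
  fixes p w :: "nat \<times> nat \<Rightarrow> real"
  assumes E: "E \<subseteq> {1..m} \<times> {1..m}" "\<And>i. (i, i) \<notin> E"
    and p: "\<And>e. e \<in> E \<Longrightarrow> 0 \<le> p e" "sum p E = 1"
    and w: "\<And>e. e \<in> E \<Longrightarrow> 0 \<le> w e" and h: "h 0 = 0"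
  obtains \<mu> where "judgment_measure m \<mu>"
    "\<And>i j. i \<in> {1..m} \<Longrightarrow> j \<in> {1..m} \<Longrightarrow> integrable \<mu> (\<lambda>Y. Y (i, j))"
    "\<And>i j. i \<in> {1..m} \<Longrightarrow> j \<in> {1..m} \<Longrightarrow>
      mean_weight \<mu> i j = (if (i, j) \<in> E then p (i, j) * w (i, j) else 0)"
    "\<And>\<alpha>. integrable (completion \<mu>) (surrogate_loss h \<phi> m \<alpha>)"
    "\<And>\<alpha>. risk \<mu> (surrogate_loss h \<phi> m) \<alpha> =
      (\<Sum>(i, j)\<in>E. p (i, j) * (h (w (i, j)) * \<phi> (\<alpha> i - \<alpha> j)))"
    "\<And>\<alpha>. risk \<mu> (pairwise_loss m) \<alpha> =
      (\<Sum>(i, j)\<in>E. p (i, j) * (w (i, j) * of_bool (if i < j then \<alpha> i \<le> \<alpha> j else \<alpha> i < \<alpha> j)))"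
proof -
  have fin: "finite E" using E(1) by (rule finite_subset) simp
  have "single_edge m e (w e) \<in> judgments m" if "e \<in> E" for e
    using that E(2) w by (cases e) (auto intro!: single_edge_in_judgments)
  from finite_judgment_measure[of E p "\<lambda>e. single_edge m e (w e)" m, OF fin p this] obtain \<mu> where \<mu>: "judgment_measure m \<mu>"
    "\<And>f :: (nat \<times> nat \<Rightarrow> real) \<Rightarrow> real. integrable (completion \<mu>) f"
    "\<And>f. (\<integral>Z. f Z \<partial>completion \<mu>) = (\<Sum>e\<in>E. p e * f (single_edge m e (w e)))"
    by blast
  have meas: "(\<lambda>Y. Y (i, j)) \<in> borel_measurable \<mu>" if "i \<in> {1..m}" "j \<in> {1..m}" for i j
  proof -
    have "(\<lambda>Y. Y (i, j)) \<in> borel_measurable (judgment_algebra m)"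
      unfolding judgment_algebra_def using that
      by (intro measurable_restrict_space1 measurable_component_singleton) auto
    then show ?thesis using \<mu>(1) by (simp add: judgment_measure_def cong: measurable_cong_sets)
  qed
  show ?thesis
  proof
    fix i j assume ij: "i \<in> {1..m}" "j \<in> {1..m}"
    show "integrable \<mu> (\<lambda>Y. Y (i, j))"
      using integrable_completion[OF meas[OF ij]] \<mu>(2) by simp
    have "mean_weight \<mu> i j = (\<Sum>e\<in>E. p e * single_edge m e (w e) (i, j))"
      unfolding mean_weight_def by (simp add: \<mu>(3) flip: integral_completion[OF meas[OF ij]])
    also have "\<dots> = (\<Sum>e\<in>E. if e = (i, j) then p (i, j) * w (i, j) else 0)"
      using ij by (intro sum.cong) (auto simp: single_edge_def)
    finally show "mean_weight \<mu> i j = (if (i, j) \<in> E then p (i, j) * w (i, j) else 0)"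
      using fin by simp
  next
    fix \<alpha>
    show "risk \<mu> (surrogate_loss h \<phi> m) \<alpha> =
        (\<Sum>(i, j)\<in>E. p (i, j) * (h (w (i, j)) * \<phi> (\<alpha> i - \<alpha> j)))"
      unfolding risk_def \<mu>(3) using E(1) h
      by (intro sum.cong) (auto simp: surrogate_loss_single_edge)
    show "risk \<mu> (pairwise_loss m) \<alpha> =
        (\<Sum>(i, j)\<in>E. p (i, j) * (w (i, j) * of_bool (if i < j then \<alpha> i \<le> \<alpha> j else \<alpha> i < \<alpha> j)))"
      unfolding risk_def \<mu>(3)
    proof (intro sum.cong refl, clarify)
      fix i j assume "(i, j) \<in> E"
      then have "i \<noteq> j" "i \<in> {1..m}" "j \<in> {1..m}" using E by auto
      from pairwise_loss_single_edge[OF this]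
      show "p (i, j) * pairwise_loss m \<alpha> (single_edge m (i, j) (w (i, j))) =
        p (i, j) * (w (i, j) * of_bool (if i < j then \<alpha> i \<le> \<alpha> j else \<alpha> i < \<alpha> j))" by simp
    qed
  qed (use \<mu> in auto)
qed

section \<open>Counterexamples on two and on three items\<close>

text \<open>The integrability clauses ensure that no mean weight or surrogate risk is 0 merely as
  the default value of the Bochner integral.\<close>

definition inconsistent_at ::
    "(real \<Rightarrow> real) \<Rightarrow> (real \<Rightarrow> real) \<Rightarrow> nat \<Rightarrow> (nat \<times> nat \<Rightarrow> real) measure \<Rightarrow> bool" where
  "inconsistent_at h \<phi> m \<mu> \<longleftrightarrow> judgment_measure m \<mu> \<and>
    (\<forall>i\<in>{1..m}. \<forall>j\<in>{1..m}. integrable \<mu> (\<lambda>Y. Y (i, j))) \<and>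
    (\<forall>\<alpha>\<in>score_vectors m. integrable (completion \<mu>) (surrogate_loss h \<phi> m \<alpha>)) \<and>
    low_noise m \<mu> \<and>
    \<not> ((INF \<alpha>\<in>score_vectors m. ereal (risk \<mu> (surrogate_loss h \<phi> m) \<alpha>))
       < (INF \<alpha>\<in>score_vectors m - optimal_scores m \<mu>. ereal (risk \<mu> (surrogate_loss h \<phi> m) \<alpha>)))"

text \<open>Pointwise domination avoids computing the infima, which can be minus infinity when
  \<open>h\<close> takes negative values.\<close>

lemma not_INF_less_INF:
  fixes r :: "'a \<Rightarrow> real"
  assumes "\<And>\<alpha>. \<alpha> \<in> A \<Longrightarrow> \<exists>\<beta>\<in>B. r \<beta> \<le> r \<alpha>"
  shows "\<not> (INF \<alpha>\<in>A. ereal (r \<alpha>)) < (INF \<beta>\<in>B. ereal (r \<beta>))"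
proof -
  have "(INF \<beta>\<in>B. ereal (r \<beta>)) \<le> (INF \<alpha>\<in>A. ereal (r \<alpha>))"
    using assms by (intro INF_mono) auto
  then show ?thesis by simp
qed

lemma not_optimal_scoresI:
  assumes "\<beta> \<in> score_vectors m" "risk \<mu> (pairwise_loss m) \<beta> < risk \<mu> (pairwise_loss m) \<alpha>"
  shows "\<alpha> \<notin> optimal_scores m \<mu>"
  using assms by (auto simp: optimal_scores_def is_arg_min_def)

text \<open>The only difference edge is 1 to 2, so low noise is vacuous and optimality demands
  \<open>\<alpha> 1 > \<alpha> 2\<close>. By \<open>le\<close>, each such gap \<open>t\<close> is
  matched by a gap \<open>s \<le> 0\<close>, which is not optimal.\<close>

lemma inconsistent_at_two_items:
  assumes h: "h 0 = 0" and pq: "0 \<le> p" "0 \<le> q" "p + q = 1"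
    and w: "0 \<le> v" "0 \<le> w" "q * w < p * v"
    and le: "\<And>t. 0 < t \<Longrightarrow> \<exists>s\<le>0. p * h v * \<phi> s + q * h w * \<phi> (- s) \<le> p * h v * \<phi> t + q * h w * \<phi> (- t)"
  shows "\<exists>\<mu>. inconsistent_at h \<phi> 2 \<mu>"
proof -
  define E :: "(nat \<times> nat) set" where "E = {(1, 2), (2, 1)}"
  define P where "P = (\<lambda>e :: nat \<times> nat. if e = (1, 2) then p else q)"
  define W where "W = (\<lambda>e :: nat \<times> nat. if e = (1, 2) then v else w)"
  obtain \<mu> where \<mu>: "judgment_measure 2 \<mu>"
    "\<And>i j. i \<in> {1..2} \<Longrightarrow> j \<in> {1..2} \<Longrightarrow> integrable \<mu> (\<lambda>Y. Y (i, j))"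
    "\<And>i j. i \<in> {1..2} \<Longrightarrow> j \<in> {1..2} \<Longrightarrow>
      mean_weight \<mu> i j = (if (i, j) \<in> E then P (i, j) * W (i, j) else 0)"
    "\<And>\<alpha>. integrable (completion \<mu>) (surrogate_loss h \<phi> 2 \<alpha>)"
    "\<And>\<alpha>. risk \<mu> (surrogate_loss h \<phi> 2) \<alpha> =
      (\<Sum>(i, j)\<in>E. P (i, j) * (h (W (i, j)) * \<phi> (\<alpha> i - \<alpha> j)))"
    "\<And>\<alpha>. risk \<mu> (pairwise_loss 2) \<alpha> =
      (\<Sum>(i, j)\<in>E. P (i, j) * (W (i, j) * of_bool (if i < j then \<alpha> i \<le> \<alpha> j else \<alpha> i < \<alpha> j)))"
    by (rule single_edge_mixture[of E 2 P W h \<phi>]) (use h pq w in \<open>auto simp: E_def P_def W_def\<close>)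
  have surrogate: "risk \<mu> (surrogate_loss h \<phi> 2) \<alpha> = p * h v * \<phi> (\<alpha> 1 - \<alpha> 2) + q * h w * \<phi> (\<alpha> 2 - \<alpha> 1)" for \<alpha>
    by (simp add: \<mu>(5) E_def P_def W_def)
  \<comment> \<open>A tie costs as much as the wrong order: the loss is non-strict on 1 to 2 and
    strict on 2 to 1.\<close>
  have pairwise: "risk \<mu> (pairwise_loss 2) \<alpha> = (if \<alpha> 1 \<le> \<alpha> 2 then p * v else q * w)" for \<alpha>
    by (simp add: \<mu>(6) E_def P_def W_def)
  have "i = 1 \<and> j = 2" if "(i, j) \<in> diff_edges 2 \<mu>" for i j
    using that w by (auto simp: diff_edges_def \<mu>(3) E_def P_def W_def split: if_splits)
  then have "False" if "(i, j) \<in> diff_edges 2 \<mu>" "(j, k) \<in> diff_edges 2 \<mu>" for i j k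
    using that by (metis numeral_eq_one_iff semiring_norm(85))
  then have low_noise: "low_noise 2 \<mu>" unfolding low_noise_def by blast
  define \<beta> where "\<beta> = (\<lambda>s. \<lambda>i\<in>{1..2::nat}. if i = 1 then s else (0::real))"
  have \<beta>: "\<beta> s \<in> score_vectors 2" "\<beta> s 1 = s" "\<beta> s 2 = 0" for s
    by (auto simp: \<beta>_def score_vectors_def)
  have nonopt: "\<alpha> \<notin> optimal_scores 2 \<mu>" if "\<alpha> 1 \<le> \<alpha> 2" for \<alpha>
    using that w by (intro not_optimal_scoresI[OF \<beta>(1)[of 1]]) (simp add: pairwise \<beta> del: One_nat_def)
  have "\<exists>\<beta>\<in>score_vectors 2 - optimal_scores 2 \<mu>.
      risk \<mu> (surrogate_loss h \<phi> 2) \<beta> \<le> risk \<mu> (surrogate_loss h \<phi> 2) \<alpha>" if \<alpha>: "\<alpha> \<in> score_vectors 2" for \<alpha>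
  proof (cases "\<alpha> 1 \<le> \<alpha> 2")
    case True
    with \<alpha> nonopt show ?thesis by blast
  next
    case False
    with le[of "\<alpha> 1 - \<alpha> 2"] obtain s where "s \<le> 0"
      "p * h v * \<phi> s + q * h w * \<phi> (- s) \<le> p * h v * \<phi> (\<alpha> 1 - \<alpha> 2) + q * h w * \<phi> (\<alpha> 2 - \<alpha> 1)"
      by auto
    then show ?thesis using nonopt[of "\<beta> s"] \<beta>
      by (intro bexI[of _ "\<beta> s"]) (auto simp: surrogate simp del: One_nat_def)
  qed
  from not_INF_less_INF[OF this] show ?thesis
    using \<mu>(1,2,4) low_noise by (auto simp: inconsistent_at_def simp del: not_less)
qed

text \<open>The subgradients at 0, \<open>t\<close> and \<open>- t\<close> are \<open>- a\<close>,
  \<open>- b\<close> and \<open>- r\<close>; for \<open>t = 0\<close> they all belong to one kink.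
  The strict gap \<open>b < r\<close> makes the weight \<open>K\<close> positive.\<close>

lemma inconsistent_at_three_items:
  assumes h: "\<And>x. 0 \<le> x \<Longrightarrow> h x = c * x" and c: "0 \<le> c"
    and sub0: "\<And>y. \<phi> y \<ge> \<phi> 0 - a * y"
    and subt: "\<And>y. \<phi> y \<ge> \<phi> t - b * (y - t)"
    and subm: "\<And>y. \<phi> y \<ge> \<phi> (- t) - r * (y + t)"
    and t: "0 \<le> t" and ab: "0 < a" "0 < b" "b < r"
  shows "\<exists>\<mu>. inconsistent_at h \<phi> 3 \<mu>"
proof -
  txt \<open>The edge weights of \<open>1 \<rightarrow> 2\<close>, \<open>1 \<rightarrow> 3\<close>, \<open>3 \<rightarrow> 1\<close>, \<open>2 \<rightarrow> 3\<close> are \<open>1\<close>, \<open>L\<close>, \<open>K\<close>, \<open>a / b\<close>. The weights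
    \<open>L\<close> and \<open>a / b\<close> solve the first-order conditions at \<open>(0, 0, - t)\<close>, namely \<open>a + b L = r K\<close> and
    \<open>b (a / b) = a\<close>. The value of \<open>K\<close> turns the low-noise inequality into an equality.\<close>
  define K where "K = (b + 2 * a) / (r - b)"
  define L where "L = K + 1 + a / b"
  have K: "0 < K" using ab by (simp add: K_def)
  have L: "K < L" using divide_pos_pos[OF ab(1,2)] by (simp add: L_def)
  have "K * (r - b) = b + 2 * a" using ab by (simp add: K_def)
  then have bL: "b * L = K * r - a" using ab by (simp add: L_def field_simps)
  define E :: "(nat \<times> nat) set" where "E = {(1, 2), (1, 3), (3, 1), (2, 3)}"
  define W where "W = (\<lambda>e :: nat \<times> nat. if e = (1, 2) then 1 else if e = (1, 3) then L
    else if e = (3, 1) then K else a / b)"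
  have items: "{1..3::nat} = {1, 2, 3}" by auto
  have h0: "h 0 = 0" using h[of 0] by simp
  obtain \<mu> where \<mu>: "judgment_measure 3 \<mu>"
    "\<And>i j. i \<in> {1..3} \<Longrightarrow> j \<in> {1..3} \<Longrightarrow> integrable \<mu> (\<lambda>Y. Y (i, j))"
    "\<And>i j. i \<in> {1..3} \<Longrightarrow> j \<in> {1..3} \<Longrightarrow>
      mean_weight \<mu> i j = (if (i, j) \<in> E then 1 / 4 * W (i, j) else 0)"
    "\<And>\<alpha>. integrable (completion \<mu>) (surrogate_loss h \<phi> 3 \<alpha>)"
    "\<And>\<alpha>. risk \<mu> (surrogate_loss h \<phi> 3) \<alpha> =
      (\<Sum>(i, j)\<in>E. 1 / 4 * (h (W (i, j)) * \<phi> (\<alpha> i - \<alpha> j)))"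
    "\<And>\<alpha>. risk \<mu> (pairwise_loss 3) \<alpha> =
      (\<Sum>(i, j)\<in>E. 1 / 4 * (W (i, j) * of_bool (if i < j then \<alpha> i \<le> \<alpha> j else \<alpha> i < \<alpha> j)))"
    by (rule single_edge_mixture[of E 3 "\<lambda>_. 1 / 4" W h \<phi>])
       (use h0 ab K L in \<open>auto simp: E_def W_def\<close>)
  \<comment> \<open>As \<open>h\<close> is linear on nonnegative weights, only the mean weights
    matter, and these are a quarter of \<open>W\<close>.\<close>
  have surrogate: "risk \<mu> (surrogate_loss h \<phi> 3) \<alpha> = c / 4 *
      (\<phi> (\<alpha> 1 - \<alpha> 2) + L * \<phi> (\<alpha> 1 - \<alpha> 3) + K * \<phi> (\<alpha> 3 - \<alpha> 1) + a / b * \<phi> (\<alpha> 2 - \<alpha> 3))" for \<alpha>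
    using ab K L by (simp add: \<mu>(5) E_def W_def h algebra_simps)
  have pairwise: "risk \<mu> (pairwise_loss 3) \<alpha> = 1 / 4 * (of_bool (\<alpha> 1 \<le> \<alpha> 2) +
      L * of_bool (\<alpha> 1 \<le> \<alpha> 3) + K * of_bool (\<alpha> 3 < \<alpha> 1) + a / b * of_bool (\<alpha> 2 \<le> \<alpha> 3))" for \<alpha>
    by (simp add: \<mu>(6) E_def W_def algebra_simps)
  have diff_edges: "(i, j) \<in> {(1, 2), (2, 3), (1, 3)}" if ij: "(i, j) \<in> diff_edges 3 \<mu>" for i j
  proof -
    from ij have "i \<in> {1..3}" "j \<in> {1..3}" by (auto simp: diff_edges_def)
    with ij K L divide_pos_pos[OF ab(1,2)] show ?thesis
      unfolding items diff_edges_def by (auto simp: \<mu>(3) E_def W_def)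
  qed
  \<comment> \<open>The only path of two difference edges is 1 to 2 to 3, so this equality settles
    low noise.\<close>
  have "diff_weight \<mu> 1 3 = diff_weight \<mu> 1 2 + diff_weight \<mu> 2 3"
    by (simp add: diff_weight_def \<mu>(3) E_def W_def L_def field_simps)
  moreover have "i = 1 \<and> j = 2 \<and> k = 3" if "(i, j) \<in> diff_edges 3 \<mu>" "(j, k) \<in> diff_edges 3 \<mu>" for i j k
    using diff_edges[OF that(1)] diff_edges[OF that(2)] by auto
  ultimately have low_noise: "low_noise 3 \<mu>"
    unfolding low_noise_def by (metis order_refl)
  define \<beta> where "\<beta> = (\<lambda>i\<in>{1..3::nat}. 3 - real i)"
  have \<beta>: "\<beta> \<in> score_vectors 3" "\<beta> 1 = 2" "\<beta> 2 = 1" "\<beta> 3 = 0"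
    by (auto simp: \<beta>_def score_vectors_def)
  define \<gamma> where "\<gamma> = (\<lambda>i\<in>{1..3::nat}. if i = 3 then - t else 0)"
  have \<gamma>: "\<gamma> \<in> score_vectors 3" "\<gamma> 1 = 0" "\<gamma> 2 = 0" "\<gamma> 3 = - t"
    by (auto simp: \<gamma>_def score_vectors_def)
  have nonopt: "\<gamma> \<notin> optimal_scores 3 \<mu>"
  proof (rule not_optimal_scoresI[OF \<beta>(1)])
    have "risk \<mu> (pairwise_loss 3) \<beta> = 1 / 4 * K"
      by (simp add: pairwise \<beta> del: One_nat_def)
    \<comment> \<open>The 1 is the cost of tying items 1 and 2. For \<open>t = 0\<close> item 3 is
      tied too, which costs \<open>L + a / b\<close> in place of \<open>K\<close>.\<close>
    moreover have "risk \<mu> (pairwise_loss 3) \<gamma> = 1 / 4 * (1 + (if t = 0 then L + a / b else K))"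
      using t by (simp add: pairwise \<gamma> del: One_nat_def)
    moreover have "K < 1 + (if t = 0 then L + a / b else K)"
      using add_strict_mono[OF L divide_pos_pos[OF ab(1,2)]] by auto
    then have "1 / 4 * K < 1 / 4 * (1 + (if t = 0 then L + a / b else K))"
      by (rule mult_strict_left_mono) simp
    ultimately show "risk \<mu> (pairwise_loss 3) \<beta> < risk \<mu> (pairwise_loss 3) \<gamma>" by (simp only:)
  qed
  have min: "risk \<mu> (surrogate_loss h \<phi> 3) \<gamma> \<le> risk \<mu> (surrogate_loss h \<phi> 3) \<alpha>" for \<alpha>
  proof -
    let ?x = "\<alpha> 1 - \<alpha> 2" and ?y = "\<alpha> 1 - \<alpha> 3" and ?z = "\<alpha> 2 - \<alpha> 3"
    \<comment> \<open>The linear parts of the four supporting lines, weighted by the edges, cancel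
      because \<open>?x + ?z = ?y\<close>.\<close>
    have "a * ?x + L * (b * (?y - t)) + K * (r * (- ?y + t)) + a / b * (b * (?z - t)) =
        a * ?x + (b * L - K * r) * (?y - t) + a * (?z - t)"
      using ab by (simp add: algebra_simps)
    also have "\<dots> = 0" unfolding bL by (simp add: algebra_simps)
    finally have "\<phi> 0 + L * \<phi> t + K * \<phi> (- t) + a / b * \<phi> t =
        (\<phi> 0 - a * ?x) + L * (\<phi> t - b * (?y - t)) + K * (\<phi> (- t) - r * (- ?y + t))
          + a / b * (\<phi> t - b * (?z - t))"
      by (simp only: right_diff_distrib)
    also have "\<dots> \<le> \<phi> ?x + L * \<phi> ?y + K * \<phi> (- ?y) + a / b * \<phi> ?z"
      using ab K L sub0[of ?x] subt[of ?y] subm[of "- ?y"] subt[of ?z]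
      by (intro add_mono mult_left_mono) auto
    finally show ?thesis
      using c by (auto simp: surrogate \<gamma> simp del: One_nat_def intro!: mult_left_mono)
  qed
  have "\<exists>\<beta>\<in>score_vectors 3 - optimal_scores 3 \<mu>.
      risk \<mu> (surrogate_loss h \<phi> 3) \<beta> \<le> risk \<mu> (surrogate_loss h \<phi> 3) \<alpha>" for \<alpha>
    using min nonopt \<gamma>(1) by blast
  from not_INF_less_INF[OF this] show ?thesis
    using \<mu>(1,2,4) low_noise by (auto simp: inconsistent_at_def simp del: not_less)
qed

section \<open>Case distinction on \<open>h\<close> and on the slope of \<open>\<phi>\<close> at
  0\<close>

lemma convex_symmetric_pair:
  fixes f :: "real \<Rightarrow> real"
  assumes "convex_on UNIV f"
  shows "2 * f 0 \<le> f t + f (- t)"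
proof -
  obtain d where d: "\<And>y. f y \<ge> f 0 + d * (y - 0)"
    using convex_subgradient_exists[OF assms] by blast
  show ?thesis using d[of t] d[of "- t"] by simp
qed

lemma inconsistent_at_exists:
  assumes \<phi>: "convex_on UNIV \<phi>" and nonneg: "\<And>x. \<phi> x \<ge> 0" and h: "h 0 = 0"
  shows "\<exists>m \<mu>. inconsistent_at h \<phi> m \<mu>"
proof (cases "\<exists>v>0. h v \<le> 0")
  case True
  then obtain v where v: "0 < v" "h v \<le> 0" by blast
  \<comment> \<open>With \<open>h v \<le> 0\<close> the surrogate risk falls as this sum grows. If
    some \<open>\<phi> x\<close> exceeds the bound, \<open>s = - \<bar>x\<bar>\<close> works by
    nonnegativity; otherwise \<open>\<phi>\<close> is bounded, hence constant.\<close>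
  have ex: "\<exists>s\<le>0. 2 * \<phi> t + \<phi> (- t) \<le> 2 * \<phi> s + \<phi> (- s)" for t
  proof (cases "\<exists>x. 2 * \<phi> t + \<phi> (- t) < \<phi> x")
    case True
    then obtain x where "2 * \<phi> t + \<phi> (- t) < \<phi> x" by blast
    then show ?thesis
      using nonneg[of x] nonneg[of "- x"]
      by (intro exI[of _ "- \<bar>x\<bar>"]) (auto simp: abs_if)
  next
    case False
    then have "\<phi> x = \<phi> 0" for x
      by (intro convex_bounded_above_const[OF \<phi>]) (auto simp: not_less)
    from this[of t] this[of "- t"] show ?thesis by (intro exI[of _ 0]) simp
  qed
  have "\<exists>s\<le>0. 2 / 3 * h v * \<phi> s + 1 / 3 * h v * \<phi> (- s) \<le>
      2 / 3 * h v * \<phi> t + 1 / 3 * h v * \<phi> (- t)" for t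
  proof -
    obtain s where "s \<le> 0" "2 * \<phi> t + \<phi> (- t) \<le> 2 * \<phi> s + \<phi> (- s)" using ex by blast
    with mult_left_mono_neg[OF this(2) v(2)] show ?thesis
      by (intro exI[of _ s]) (simp add: algebra_simps)
  qed
  then show ?thesis
    using inconsistent_at_two_items[of h "2 / 3" "1 / 3" v v \<phi>] h v(1) by auto
next
  case False
  then have hpos: "0 < h v" if "0 < v" for v using that by force
  show ?thesis
  proof (cases "\<exists>v>0. \<exists>w>0. h v * w < h w * v")
    case True
    then obtain v w where vw: "0 < v" "0 < w" "h v * w < h w * v" by blast
    \<comment> \<open>These probabilities balance \<open>p * h v = q * h w\<close>, so a tie
      minimises the surrogate risk, while \<open>h v * w < h w * v\<close> still makes the mean
      weights differ.\<close>
    define p q where "p = h w / (h v + h w)" and "q = h v / (h v + h w)"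
    have pos: "0 < h v" "0 < h w" using hpos vw by auto
    have pq: "0 \<le> p" "0 \<le> q" "p + q = 1" "q * h w = p * h v" "0 \<le> p * h v"
      using pos by (auto simp: p_def q_def divide_simps)
    have "q * w < p * v"
      using pos vw by (simp add: p_def q_def divide_strict_right_mono)
    moreover have "p * h v * \<phi> 0 + q * h w * \<phi> (- 0) \<le> p * h v * \<phi> t + q * h w * \<phi> (- t)" for t
      using mult_left_mono[OF convex_symmetric_pair[OF \<phi>, of t] pq(5)] unfolding pq(4)
      by (simp add: algebra_simps)
    ultimately show ?thesis
      using inconsistent_at_two_items[of h p q v w \<phi>] h vw pq by (meson less_imp_le order_refl)
  next
    case False
    have linear: "h x = h 1 * x" if "0 \<le> x" for x
    proof (cases "x = 0")
      case False': False
      with that have "0 < x" by simp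
      then have "\<not> h x * 1 < h 1 * x" "\<not> h 1 * x < h x * 1"
        using False by (meson zero_less_one)+
      then show ?thesis by simp
    qed (simp add: h)
    obtain d where d: "\<And>y. \<phi> y \<ge> \<phi> 0 + d * y"
      using convex_subgradient_exists[OF \<phi>, of 0] by auto
    show ?thesis
    proof (cases "0 \<le> d")
      case True
      have "\<phi> 0 \<le> \<phi> t" if "0 < t" for t
        using d[of t] True that by (smt (verit) mult_nonneg_nonneg)
      then show ?thesis
        using inconsistent_at_two_items[of h 1 0 1 1 \<phi>] h hpos[of 1] by fastforce
    next
      case False
      \<comment> \<open>Any slope strictly between \<open>d\<close> and 0 would serve as well as
        \<open>d / 2\<close>.\<close>
      then obtain t where t: "0 \<le> t" "\<And>y. \<phi> y \<ge> \<phi> t + d / 2 * (y - t)"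
        using convex_subgradient_of_slope[OF \<phi> nonneg d, of "d / 2"] by auto
      \<comment> \<open>Subgradients are monotone: for \<open>t > 0\<close>, evaluate the supporting
        lines at 0 and \<open>- t\<close> at each other's base point. For \<open>t = 0\<close> take
        \<open>d\<close> itself.\<close>
      have "\<exists>e\<le>d. \<forall>y. \<phi> y \<ge> \<phi> (- t) + e * (y + t)"
      proof (cases "t = 0")
        case True
        then show ?thesis using d by auto
      next
        case False
        obtain e where e: "\<And>y. \<phi> y \<ge> \<phi> (- t) + e * (y + t)"
          using convex_subgradient_exists[OF \<phi>, of "- t"] by auto
        have "e * t \<le> d * t" using d[of "- t"] e[of 0] by simp
        then show ?thesis using e False t(1) by auto
      qed
      then obtain e where e: "e \<le> d" "\<And>y. \<phi> y \<ge> \<phi> (- t) + e * (y + t)" by blast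
      have "\<exists>\<mu>. inconsistent_at h \<phi> 3 \<mu>"
        by (rule inconsistent_at_three_items[of h "h 1" \<phi> "- d" t "- (d / 2)" "- e", OF linear])
           (use hpos[of 1] d t e False in auto)
      then show ?thesis by blast
    qed
  qed
qed

theorem theorem2:
  fixes \<phi> h :: "real \<Rightarrow> real"
  assumes "convex_on UNIV \<phi>" and "\<And>x. \<phi> x \<ge> 0" and "h 0 = 0"
  shows "\<exists>(m::nat) \<mu>. judgment_measure m \<mu> \<and>
    (\<forall>i\<in>{1..m}. \<forall>j\<in>{1..m}. integrable \<mu> (\<lambda>Y. Y (i, j))) \<and>
    (\<forall>\<alpha>\<in>score_vectors m. integrable (completion \<mu>) (surrogate_loss h \<phi> m \<alpha>)) \<and>
    low_noise m \<mu> \<and>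
    \<not> ((INF \<alpha>\<in>score_vectors m. ereal (risk \<mu> (surrogate_loss h \<phi> m) \<alpha>))
       < (INF \<alpha>\<in>score_vectors m - optimal_scores m \<mu>. ereal (risk \<mu> (surrogate_loss h \<phi> m) \<alpha>)))"
  using inconsistent_at_exists[of \<phi> h, OF assms] unfolding inconsistent_at_def .

end
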